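(* Let $\mathcal{E}=\{(X^*,\mathcal{H},m);\ \mathbb{R}^n_+;\ e;\ \{\succ_a\}_{a\in X^*}\}$ be a pure exchange economy satisfying all the standing assumptions listed in the context. Then $W(\mathcal{E})\subset C(\mathcal{E})$.
   Context: Fuzzy measures and Choquet integral. A fuzzy measure on a measurable space $(Z,\mathcal{F})$ is a set function $\mu:\mathcal{F}\to[0,\infty)$ with $\mu(\emptyset)=0$ that is monotone ($A\subset B$ implies $\mu(A)\le\mu(B)$); no additivity is assumed. It is subadditive if $\mu(A\cup B)\le\mu(A)+\mu(B)$, and submodular if $\mu(A\cup B)+\mu(A\cap B)\le\mu(A)+\mu(B)$, for all $A,B$. For measurable $f:Z\to[0,\infty)$ the Choquet integral is $\int f\,d\mu=\int_0^\infty\mu(\{f>t\})\,dt$; for $A\in\mathcal{F}$, $\int_A f\,d\mu=\int f1_A\,d\mu$; $f\in L^1_C(\mu)$ means $f$ is measurable with $\int f\,d\mu<\infty$. For $\mathbb{R}^n_+$-valued functions, measurability, integrability ($L^1_C(\mu,\mathbb{R}^n_+)$) and the integral are taken componentwise. "$\mu$-a.e." means outside a set contained in some $N\in\mathcal F$ with $\mu(N)=0$. Product space. $(X,\mathcal{A})$ is a measurable space, $\mathcal{B}$ is the Borel $\sigma$-algebra of $[0,1]$ (measurability on $[0,1]$ refers to $\mathcal B$), $X^*=X\times[0,1]$, and $\mathcal{H}$ is the product $\sigma$-algebra of $\mathcal{A}$ and $\mathcal{B}$. For $H\in\mathcal{H}$, $H_y=\{x\in X:(x,y)\in H\}$. Integrals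 $dy$ are with respect to Lebesgue measure. A fuzzy measure $m$ on $\mathcal{H}$ is decomposable if for each $y\in[0,1]$ there is a non-trivial fuzzy measure $\mu_y$ on $\mathcal{A}$ such that the $\mu_y$ are equibounded, $y\mapsto\mu_y(H_y)$ is measurable for all $H\in\mathcal{H}$, and $m(H)=\int_0^1\mu_y(H_y)\,dy$ for all $H\in\mathcal{H}$. A decomposable $m$ is of convex type if the measures $\mu_y$ are uniformly filtering: for every $A\in\mathcal{A}$ there is a family $(A_t)_{t\in[0,1]}\subset\mathcal{A}$ of subsets of $A$, the same for all $y$, with $A_0=\emptyset$, $A_1=A$, $\mu_y(A_t)=t\mu_y(A)$, and, for $t<t'$, $A_t\subset A_{t'}$ and $\mu_y(A_{t'}\setminus A_t)=(t'-t)\mu_y(A)$, for all $y\in[0,1]$. A function $f$ on $X^*$ is sectional if $f(x,y)=\varphi(y)$ for all $(x,y)$, for some measurable $\varphi$ on $[0,1]$; one then writes $f(y)$ for $f(x,y)$. Economy: standing assumptions. (1) $m$ is a fuzzy measure of convex type on $\mathcal{H}$, each $\mu_y$ is subadditive, $m$ is submodular, the family of $m$-null sets is stable under countable unions, and $\mu_y(X)=m(X^* )=1$ for all $y$. (2) The initial endowment density $e:X^*\to(\mathbb{R}^n_+)^{\circ}$ (interior of $\mathbb{R}^n_+$) is sectional and $e\in L^1_C(m,\mathbb{R}^n_+)$. (3) For each agent $a\in X^*$ there is a preorder $\succeq_a$ on $\mathbb{R}^n_+$ with strict part $\succ_a$ ($u\succ_a v$ iff $u\succeq_a v$ and not $v\succeq_a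 u$), such that: (monotonicity) $u+v\succ_a u$ for all $u\in\mathbb{R}^n_+$, $v\in\mathbb{R}^n_+\setminus\{0\}$, $a\in X^*$; (continuity) for all $u\in(\mathbb{R}^n_+)^{\circ}$ and $a\in X^*$ the set $\{v\in\mathbb{R}^n_+: v\succeq_a u\}$ is closed in $\mathbb{R}^n_+$; and $\succeq_{(x,y)}$ depends only on $y$, and is written $\succeq_y$. Economic notions. An allocation is a measurable function $f:X^*\to\mathbb{R}^n_+$; it is feasible if $\int_{X^*}f\,dm=\int_{X^*}e\,dm$. A price is $p\in\mathbb{R}^n_+\setminus\{0\}$; the budget set is $B_p(a)=\{u\in\mathbb{R}^n_+: p\cdot u\le p\cdot e(a)\}$. A coalition is $S\in\mathcal{H}$ with $m(S)>0$. A coalition $S$ can improve an allocation $f$ if there is an allocation $g$ with $g(a)\succ_a f(a)$ $m$-a.e. in $S$ and $\int_S g\,dm=\int_S e\,dm$. The core $C(\mathcal{E})$ is the set of feasible allocations that cannot be improved by any coalition. A Walras equilibrium is a pair $(f,p)\in L^1_C(m,\mathbb{R}^n_+)\times(\mathbb{R}^n_+\setminus\{0\})$ such that $f$ is a feasible allocation and, for $m$-almost all $a$, $f(a)\in B_p(a)$ and $u\succ_a f(a)$ implies $p\cdot u>p\cdot e(a)$. $W(\mathcal{E})$ is the set of feasible allocations $f$ for which some price $p$ makes $(f,p)$ a Walras equilibrium. *)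

theory Defs
  imports "HOL-Analysis.Analysis"
begin

section \<open>Fuzzy measures and the Choquet integral\<close>

text \<open>
  Throughout, an argument \<open>F :: 'z measure\<close> stands for the measurable space
  \<open>(space F, sets F)\<close> only; the measure it carries is never used. Set functions are total
  functions, constrained only on \<open>sets F\<close>.
\<close>

definition fuzzy_measure :: "'z measure \<Rightarrow> ('z set \<Rightarrow> real) \<Rightarrow> bool" where
  "fuzzy_measure F \<mu> \<longleftrightarrow>
     \<mu> {} = 0 \<and> (\<forall>A\<in>sets F. 0 \<le> \<mu> A) \<and>
     (\<forall>A\<in>sets F. \<forall>B\<in>sets F. A \<subseteq> B \<longrightarrow> \<mu> A \<le> \<mu> B)"

definition nontrivial_on :: "'z measure \<Rightarrow> ('z set \<Rightarrow> real) \<Rightarrow> bool" where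
  "nontrivial_on F \<mu> \<longleftrightarrow> (\<exists>A\<in>sets F. \<mu> A \<noteq> 0)"

definition subadditive_on :: "'z measure \<Rightarrow> ('z set \<Rightarrow> real) \<Rightarrow> bool" where
  "subadditive_on F \<mu> \<longleftrightarrow> (\<forall>A\<in>sets F. \<forall>B\<in>sets F. \<mu> (A \<union> B) \<le> \<mu> A + \<mu> B)"

definition submodular_on :: "'z measure \<Rightarrow> ('z set \<Rightarrow> real) \<Rightarrow> bool" where
  "submodular_on F \<mu> \<longleftrightarrow>
     (\<forall>A\<in>sets F. \<forall>B\<in>sets F. \<mu> (A \<union> B) + \<mu> (A \<inter> B) \<le> \<mu> A + \<mu> B)"

definition null_sets_countably_stable :: "'z measure \<Rightarrow> ('z set \<Rightarrow> real) \<Rightarrow> bool" where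
  "null_sets_countably_stable F \<mu> \<longleftrightarrow>
     (\<forall>N :: nat \<Rightarrow> 'z set. (\<forall>k. N k \<in> sets F \<and> \<mu> (N k) = 0) \<longrightarrow> \<mu> (\<Union>k. N k) = 0)"

definition fuzzy_ae_in :: "'z measure \<Rightarrow> ('z set \<Rightarrow> real) \<Rightarrow> 'z set \<Rightarrow> ('z \<Rightarrow> bool) \<Rightarrow> bool" where
  "fuzzy_ae_in F \<mu> S P \<longleftrightarrow> (\<exists>N\<in>sets F. \<mu> N = 0 \<and> (\<forall>z\<in>S - N. P z))"

text \<open>For measurable nonnegative \<open>f\<close>; the value may be \<open>\<infinity>\<close>.\<close>

definition choquet :: "'z measure \<Rightarrow> ('z set \<Rightarrow> real) \<Rightarrow> ('z \<Rightarrow> real) \<Rightarrow> ennreal" where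
  "choquet F \<mu> f = (\<integral>\<^sup>+t\<in>{0..}. ennreal (\<mu> {z \<in> space F. t < f z}) \<partial>lborel)"

definition choquet_on :: "'z measure \<Rightarrow> ('z set \<Rightarrow> real) \<Rightarrow> 'z set \<Rightarrow> ('z \<Rightarrow> real) \<Rightarrow> ennreal" where
  "choquet_on F \<mu> A f = choquet F \<mu> (\<lambda>z. f z * indicator A z)"

definition choquet_vec ::
    "'z measure \<Rightarrow> ('z set \<Rightarrow> real) \<Rightarrow> 'z set \<Rightarrow> ('z \<Rightarrow> real ^ 'n) \<Rightarrow> ennreal ^ 'n" where
  "choquet_vec F \<mu> A f = (\<chi> i. choquet_on F \<mu> A (\<lambda>z. f z $ i))"

definition orthant :: "(real ^ 'n) set" where
  "orthant = {u. \<forall>i. 0 \<le> u $ i}"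

definition measurable_vec :: "'z measure \<Rightarrow> ('z \<Rightarrow> real ^ 'n) \<Rightarrow> bool" where
  "measurable_vec F f \<longleftrightarrow> (\<forall>i. (\<lambda>z. f z $ i) \<in> borel_measurable F)"

definition L1_choquet :: "'z measure \<Rightarrow> ('z set \<Rightarrow> real) \<Rightarrow> ('z \<Rightarrow> real ^ 'n) set" where
  "L1_choquet F \<mu> = {f. (\<forall>z\<in>space F. f z \<in> orthant) \<and> measurable_vec F f \<and>
     (\<forall>i. choquet F \<mu> (\<lambda>z. f z $ i) < \<infinity>)}"


section \<open>Decomposable fuzzy measures of convex type\<close>

abbreviation unit_borel :: "real measure" where
  "unit_borel \<equiv> restrict_space borel {0..1}"

text \<open>Only \<open>space\<close> and \<open>sets\<close> of this product are used: \<open>X \<times> [0,1]\<close> with the product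
  \<open>\<sigma>\<close>-algebra.\<close>

abbreviation agents :: "'x measure \<Rightarrow> ('x \<times> real) measure" where
  "agents M \<equiv> M \<Otimes>\<^sub>M unit_borel"

definition section_at :: "'x measure \<Rightarrow> ('x \<times> real) set \<Rightarrow> real \<Rightarrow> 'x set" where
  "section_at M H y = {x \<in> space M. (x, y) \<in> H}"

text \<open>The family \<open>\<mu>\<close> witnesses that \<open>m\<close> is decomposable. It is carried along explicitly since
  being of convex type, and further hypotheses on an economy, refer to it.\<close>

definition decomposition ::
    "'x measure \<Rightarrow> (real \<Rightarrow> 'x set \<Rightarrow> real) \<Rightarrow> (('x \<times> real) set \<Rightarrow> real) \<Rightarrow> bool" where
  "decomposition M \<mu> m \<longleftrightarrow>
     (\<forall>y\<in>{0..1}. fuzzy_measure M (\<mu> y) \<and> nontrivial_on M (\<mu> y)) \<and>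
     (\<exists>K. \<forall>y\<in>{0..1}. \<forall>A\<in>sets M. \<mu> y A \<le> K) \<and>
     (\<forall>H\<in>sets (agents M). (\<lambda>y. \<mu> y (section_at M H y)) \<in> borel_measurable unit_borel) \<and>
     (\<forall>H\<in>sets (agents M). m H = (LBINT y:{0..1}. \<mu> y (section_at M H y)))"

definition uniformly_filtering :: "'x measure \<Rightarrow> (real \<Rightarrow> 'x set \<Rightarrow> real) \<Rightarrow> bool" where
  "uniformly_filtering M \<mu> \<longleftrightarrow>
     (\<forall>A\<in>sets M. \<exists>T :: real \<Rightarrow> 'x set.
        (\<forall>t\<in>{0..1}. T t \<in> sets M \<and> T t \<subseteq> A) \<and> T 0 = {} \<and> T 1 = A \<and>
        (\<forall>t\<in>{0..1}. \<forall>y\<in>{0..1}. \<mu> y (T t) = t * \<mu> y A) \<and>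
        (\<forall>t\<in>{0..1}. \<forall>t'\<in>{0..1}. t < t' \<longrightarrow>
           T t \<subseteq> T t' \<and> (\<forall>y\<in>{0..1}. \<mu> y (T t' - T t) = (t' - t) * \<mu> y A)))"

definition convex_type ::
    "'x measure \<Rightarrow> (real \<Rightarrow> 'x set \<Rightarrow> real) \<Rightarrow> (('x \<times> real) set \<Rightarrow> real) \<Rightarrow> bool" where
  "convex_type M \<mu> m \<longleftrightarrow>
     fuzzy_measure (agents M) m \<and> decomposition M \<mu> m \<and> uniformly_filtering M \<mu>"

definition sectional :: "'x measure \<Rightarrow> ('x \<times> real \<Rightarrow> real ^ 'n) \<Rightarrow> bool" where
  "sectional M f \<longleftrightarrow> (\<exists>\<phi>. measurable_vec unit_borel \<phi> \<and>
     (\<forall>x\<in>space M. \<forall>y\<in>{0..1}. f (x, y) = \<phi> y))"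


section \<open>The pure exchange economy\<close>

text \<open>\<open>(u, v) \<in> pref a\<close> means that agent \<open>a\<close> weakly prefers \<open>u\<close> to \<open>v\<close>, and
  \<open>strictly_prefers pref a u v\<close> that the preference is strict.\<close>

definition strictly_prefers :: "('a \<Rightarrow> (real ^ 'n) rel) \<Rightarrow> 'a \<Rightarrow> real ^ 'n \<Rightarrow> real ^ 'n \<Rightarrow> bool" where
  "strictly_prefers pref a u v \<longleftrightarrow> (u, v) \<in> pref a \<and> (v, u) \<notin> pref a"

locale exchange_economy =
  fixes M :: "'x measure"
    and \<mu> :: "real \<Rightarrow> 'x set \<Rightarrow> real"
    and m :: "('x \<times> real) set \<Rightarrow> real"
    and e :: "'x \<times> real \<Rightarrow> real ^ 'n"
    and pref :: "'x \<times> real \<Rightarrow> (real ^ 'n) rel"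
  assumes convex_type: "convex_type M \<mu> m"
    and subadditive: "\<And>y. y \<in> {0..1} \<Longrightarrow> subadditive_on M (\<mu> y)"
    and submodular: "submodular_on (agents M) m"
    and null_stable: "null_sets_countably_stable (agents M) m"
    and normalized_sections: "\<And>y. y \<in> {0..1} \<Longrightarrow> \<mu> y (space M) = 1"
    and normalized: "m (space (agents M)) = 1"
    and endowment_interior: "\<And>a. a \<in> space (agents M) \<Longrightarrow> e a \<in> interior orthant"
    and endowment_sectional: "sectional M e"
    and endowment_integrable: "e \<in> L1_choquet (agents M) m"
    and preorder: "\<And>a. a \<in> space (agents M) \<Longrightarrow> preorder_on orthant (pref a)"
    and monotone: "\<And>a u v. a \<in> space (agents M) \<Longrightarrow> u \<in> orthant \<Longrightarrow> v \<in> orthant - {0} \<Longrightarrow>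
          strictly_prefers pref a (u + v) u"
    and continuous: "\<And>a u. a \<in> space (agents M) \<Longrightarrow> u \<in> interior orthant \<Longrightarrow>
          closedin (top_of_set orthant) {v \<in> orthant. (v, u) \<in> pref a}"
    and pref_sectional: "\<And>x x' y. x \<in> space M \<Longrightarrow> x' \<in> space M \<Longrightarrow> y \<in> {0..1} \<Longrightarrow>
          pref (x, y) = pref (x', y)"

text \<open>The following notions take an arbitrary measurable space \<open>F\<close> of agents with a set function
  \<open>m\<close>. Allocations are total functions whose values outside \<open>space F\<close> are irrelevant.\<close>

definition allocation :: "'a measure \<Rightarrow> ('a \<Rightarrow> real ^ 'n) \<Rightarrow> bool" where
  "allocation F f \<longleftrightarrow> (\<forall>a\<in>space F. f a \<in> orthant) \<and> measurable_vec F f"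

definition feasible_allocation ::
    "'a measure \<Rightarrow> ('a set \<Rightarrow> real) \<Rightarrow> ('a \<Rightarrow> real ^ 'n) \<Rightarrow> ('a \<Rightarrow> real ^ 'n) \<Rightarrow> bool" where
  "feasible_allocation F m e f \<longleftrightarrow>
     allocation F f \<and> choquet_vec F m (space F) f = choquet_vec F m (space F) e"

definition price :: "real ^ 'n \<Rightarrow> bool" where
  "price p \<longleftrightarrow> p \<in> orthant - {0}"

definition budget_set :: "('a \<Rightarrow> real ^ 'n) \<Rightarrow> real ^ 'n \<Rightarrow> 'a \<Rightarrow> (real ^ 'n) set" where
  "budget_set e p a = {u \<in> orthant. p \<bullet> u \<le> p \<bullet> e a}"

definition coalition :: "'a measure \<Rightarrow> ('a set \<Rightarrow> real) \<Rightarrow> 'a set \<Rightarrow> bool" where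
  "coalition F m S \<longleftrightarrow> S \<in> sets F \<and> 0 < m S"

definition can_improve :: "'a measure \<Rightarrow> ('a set \<Rightarrow> real) \<Rightarrow> ('a \<Rightarrow> real ^ 'n) \<Rightarrow>
    ('a \<Rightarrow> (real ^ 'n) rel) \<Rightarrow> 'a set \<Rightarrow> ('a \<Rightarrow> real ^ 'n) \<Rightarrow> bool" where
  "can_improve F m e pref S f \<longleftrightarrow>
     (\<exists>g. allocation F g \<and>
        fuzzy_ae_in F m S (\<lambda>a. strictly_prefers pref a (g a) (f a)) \<and>
        choquet_vec F m S g = choquet_vec F m S e)"

definition core :: "'a measure \<Rightarrow> ('a set \<Rightarrow> real) \<Rightarrow> ('a \<Rightarrow> real ^ 'n) \<Rightarrow>
    ('a \<Rightarrow> (real ^ 'n) rel) \<Rightarrow> ('a \<Rightarrow> real ^ 'n) set" where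
  "core F m e pref = {f. feasible_allocation F m e f \<and>
     \<not> (\<exists>S. coalition F m S \<and> can_improve F m e pref S f)}"

definition walras_equilibrium :: "'a measure \<Rightarrow> ('a set \<Rightarrow> real) \<Rightarrow> ('a \<Rightarrow> real ^ 'n) \<Rightarrow>
    ('a \<Rightarrow> (real ^ 'n) rel) \<Rightarrow> ('a \<Rightarrow> real ^ 'n) \<Rightarrow> real ^ 'n \<Rightarrow> bool" where
  "walras_equilibrium F m e pref f p \<longleftrightarrow>
     f \<in> L1_choquet F m \<and> price p \<and> feasible_allocation F m e f \<and>
     fuzzy_ae_in F m (space F) (\<lambda>a. f a \<in> budget_set e p a \<and>
       (\<forall>u\<in>orthant. strictly_prefers pref a u (f a) \<longrightarrow> p \<bullet> u > p \<bullet> e a))"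

definition walras_allocations :: "'a measure \<Rightarrow> ('a set \<Rightarrow> real) \<Rightarrow> ('a \<Rightarrow> real ^ 'n) \<Rightarrow>
    ('a \<Rightarrow> (real ^ 'n) rel) \<Rightarrow> ('a \<Rightarrow> real ^ 'n) set" where
  "walras_allocations F m e pref = {f. feasible_allocation F m e f \<and>
     (\<exists>p. walras_equilibrium F m e pref f p)}"

end

theory Submission
  imports Defs
begin

text \<open>
  If a coalition \<open>S\<close> improves a Walras allocation through \<open>g\<close>, then \<open>p \<bullet> g > p \<bullet> e\<close> almost everywhere
  in \<open>S\<close>. Submodularity of \<open>m\<close> makes the Choquet integral subadditive, and Tonelli makes it additive
  on sectional functions, so
  \<open>\<integral>\<^sub>S p \<bullet> g dm \<le> \<Sum>\<^sub>i p\<^sub>i \<integral>\<^sub>S g\<^sub>i dm = \<Sum>\<^sub>i p\<^sub>i \<integral>\<^sub>S e\<^sub>i dm = \<integral>\<^sub>S p \<bullet> e dm < \<infinity>\<close>.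
  Decomposability splits \<open>m\<close> additively along sectional sets, which together with the stability of
  null sets forces \<open>m S = 0\<close>. Subadditivity is obtained without any continuity of \<open>m\<close>: for
  functions with values in the natural numbers it is a telescoping sum of submodular inequalities,
  and the discretisation error stays bounded when the functions are scaled up.
\<close>

section \<open>Fuzzy measures and first properties of the Choquet integral\<close>

lemma fuzzy_measureD:
  assumes "fuzzy_measure F m"
  shows "m {} = 0"
    and "A \<in> sets F \<Longrightarrow> 0 \<le> m A"
    and "A \<in> sets F \<Longrightarrow> B \<in> sets F \<Longrightarrow> A \<subseteq> B \<Longrightarrow> m A \<le> m B"
  using assms by (auto simp: fuzzy_measure_def)

lemma submodular_imp_subadditive:
  assumes "fuzzy_measure F m" and "submodular_on F m" and "A \<in> sets F" and "B \<in> sets F"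
  shows "m (A \<union> B) \<le> m A + m B"
proof -
  have "m (A \<union> B) + m (A \<inter> B) \<le> m A + m B"
    using assms by (auto simp: submodular_on_def)
  moreover have "0 \<le> m (A \<inter> B)"
    using assms by (auto intro: fuzzy_measureD(2))
  ultimately show ?thesis by linarith
qed

lemma layer_sets:
  assumes "S \<in> sets F" and [measurable]: "f \<in> borel_measurable F"
  shows "{z \<in> S. (t::real) < f z} \<in> sets F"
proof -
  have "{z \<in> S. t < f z} = S \<inter> {z \<in> space F. t < f z}"
    using sets.sets_into_space[OF assms(1)] by auto
  also have "\<dots> \<in> sets F" using assms(1) by measurable
  finally show ?thesis .
qed

text \<open>Layers shrink as the level rises, so the function is antitone in \<open>t\<close>, and
  monotone functions are Borel.\<close>

lemma layer_measurable:
  assumes "fuzzy_measure F m" and "S \<in> sets F" and "f \<in> borel_measurable F"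
  shows "(\<lambda>t::real. m {z \<in> S. t < f z}) \<in> borel_measurable borel"
proof -
  have "mono (\<lambda>t::real. - m {z \<in> S. t < f z})"
    by (rule monoI) (auto intro!: fuzzy_measureD(3)[OF assms(1)] layer_sets assms(2,3))
  from borel_measurable_uminus[OF borel_measurable_mono[OF this]] show ?thesis by simp
qed

lemma choquet_cong:
  assumes "\<And>z. z \<in> space F \<Longrightarrow> f z = g z"
  shows "choquet F m f = choquet F m g"
proof -
  have "{z \<in> space F. t < f z} = {z \<in> space F. t < g z}" for t
    using assms by auto
  then show ?thesis by (simp add: choquet_def)
qed

lemma choquet_mono:
  assumes "fuzzy_measure F m" and [measurable]: "f \<in> borel_measurable F" "g \<in> borel_measurable F"
    and "\<And>z. z \<in> space F \<Longrightarrow> f z \<le> g z"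
  shows "choquet F m f \<le> choquet F m g"
  unfolding choquet_def using assms(4)
  by (intro nn_integral_mono mult_right_mono ennreal_leI fuzzy_measureD(3)[OF assms(1)])
     (auto intro: less_le_trans)

lemma choquet_zero:
  assumes "fuzzy_measure F m"
  shows "choquet F m (\<lambda>_. 0) = 0"
proof -
  have "ennreal (m {z \<in> space F. t < 0}) * indicator {0..} t = 0" for t :: real
    by (cases "0 \<le> t") (simp_all add: fuzzy_measureD(1)[OF assms])
  then show ?thesis unfolding choquet_def by (simp only: nn_integral_const mult_zero_left)
qed

lemma choquet_mult:
  assumes m: "fuzzy_measure F m" and f [measurable]: "f \<in> borel_measurable F" and c: "0 \<le> c"
  shows "choquet F m (\<lambda>z. c * f z) = ennreal c * choquet F m f"
proof (cases "c = 0")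
  case True
  then show ?thesis using choquet_zero[OF m] by simp
next
  case False
  with c have c: "0 < c" by simp
  have [measurable]: "(\<lambda>t::real. m {z \<in> space F. t < c * f z}) \<in> borel_measurable borel"
    by (rule layer_measurable[OF m]) simp_all
  \<comment> \<open>Change of variable from \<open>t\<close> to \<open>c * t\<close>, for which
    \<open>c = 0\<close> had to be treated apart.\<close>
  have "choquet F m (\<lambda>z. c * f z) =
      ennreal \<bar>c\<bar> * (\<integral>\<^sup>+t. ennreal (m {z \<in> space F. 0 + c * t < c * f z}) * indicator {0..} (0 + c * t) \<partial>lborel)"
    unfolding choquet_def using c by (intro nn_integral_real_affine) simp_all
  also have "\<dots> = ennreal c * choquet F m f"
    using c by (auto simp: choquet_def indicator_def zero_le_mult_iff)
  finally show ?thesis .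
qed

section \<open>Subadditivity of the Choquet integral\<close>

text \<open>Raising \<open>u\<close> by one on \<open>B\<close> enlarges its layer at level
  \<open>j + 1\<close> by the points of \<open>B\<close> already in the layer at level
  \<open>j\<close>; submodularity bounds the cost of each enlargement. Stopping at \<open>J\<close>
  keeps the sums finite and real.\<close>

lemma layer_sum_add_indicator:
  fixes u :: "'z \<Rightarrow> nat"
  assumes m: "fuzzy_measure F m" and sm: "submodular_on F m"
    and [measurable]: "u \<in> measurable F (count_space UNIV)" "B \<in> sets F"
  shows "(\<Sum>j<J. m {z \<in> space F. j < u z + of_bool (z \<in> B)}) \<le>
    (\<Sum>j<J. m {z \<in> space F. j < u z}) + m B"
proof (cases J)
  case 0
  then show ?thesis using fuzzy_measureD(2)[OF m, of B] by simp
next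
  case (Suc K)
  have B: "z \<in> space F" if "z \<in> B" for z
    using that sets.sets_into_space[OF assms(4)] by auto
  define A where "A = (\<lambda>j. {z \<in> space F. j < u z})"
  define C where "C = (\<lambda>j. {z \<in> space F. j < u z + of_bool (z \<in> B)})"
  have [measurable]: "A j \<in> sets F" for j unfolding A_def by measurable
  \<comment> \<open>The errors in the submodular inequality telescope; the extra term on the left is what is
    left over from level \<open>K\<close>.\<close>
  have "(\<Sum>j<Suc K. m (C j)) + m (A K \<inter> B) \<le> (\<Sum>j<Suc K. m (A j)) + m B"
  proof (induction K)
    case 0
    have "C 0 = A 0 \<union> B" using B by (auto simp: A_def C_def)
    then show ?case using sm by (auto simp: submodular_on_def)
  next
    case (Suc K)
    have "C (Suc K) = A (Suc K) \<union> (A K \<inter> B)"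
      by (auto simp: A_def C_def)
    moreover have "A (Suc K) \<inter> B = A (Suc K) \<inter> (A K \<inter> B)"
      by (auto simp: A_def)
    ultimately have "m (C (Suc K)) + m (A (Suc K) \<inter> B) \<le> m (A (Suc K)) + m (A K \<inter> B)"
      using sm by (auto simp: submodular_on_def)
    with Suc show ?case by simp
  qed
  moreover have "0 \<le> m (A K \<inter> B)" by (rule fuzzy_measureD(2)[OF m]) simp
  ultimately show ?thesis using Suc by (simp add: A_def C_def)
qed

text \<open>\<open>v\<close> is the sum of the indicators of its layers \<open>{K < v}\<close>, and
  the previous lemma adds them one at a time: capping \<open>v\<close> at \<open>K + 1\<close>
  instead of \<open>K\<close> adds exactly the indicator with index \<open>K\<close>.\<close>

lemma layer_sum_add_le:
  fixes u v :: "'z \<Rightarrow> nat"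
  assumes m: "fuzzy_measure F m" and sm: "submodular_on F m"
    and [measurable]: "u \<in> measurable F (count_space UNIV)" "v \<in> measurable F (count_space UNIV)"
  shows "(\<Sum>j<J. m {z \<in> space F. j < u z + v z}) \<le>
    (\<Sum>j<J. m {z \<in> space F. j < u z}) + (\<Sum>j<J. m {z \<in> space F. j < v z})"
proof -
  have "(\<Sum>j<J. m {z \<in> space F. j < u z + min (v z) K}) \<le>
      (\<Sum>j<J. m {z \<in> space F. j < u z}) + (\<Sum>j<K. m {z \<in> space F. j < v z})" for K
  proof (induction K)
    case 0
    then show ?case by simp
  next
    case (Suc K)
    have eq: "{z \<in> space F. j < u z + min (v z) (Suc K)} =
        {z \<in> space F. j < u z + min (v z) K + of_bool (z \<in> {z \<in> space F. K < v z})}" for j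
      by (auto simp: min_def not_less not_less_eq_eq split: if_splits)
    have "(\<Sum>j<J. m {z \<in> space F. j < u z + min (v z) (Suc K)}) \<le>
        (\<Sum>j<J. m {z \<in> space F. j < u z + min (v z) K}) + m {z \<in> space F. K < v z}"
      unfolding eq by (rule layer_sum_add_indicator[OF m sm]) measurable
    with Suc show ?case by simp
  qed
  \<comment> \<open>The cap is invisible at the levels counted: where \<open>v\<close> exceeds
    \<open>J\<close>, both sums exceed every \<open>j < J\<close>.\<close>
  moreover have "{z \<in> space F. j < u z + min (v z) J} = {z \<in> space F. j < u z + v z}" if "j < J" for j
    using that by auto
  ultimately show ?thesis by (metis (mono_tags, lifting) lessThan_iff sum.cong)
qed

text \<open>The integer part is constant on each unit interval. This turns sums over integer levels
  into integrals over real levels, the form of \<open>choquet\<close>.\<close>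

lemma nn_integral_nat_floor:
  fixes U :: "nat \<Rightarrow> ennreal"
  shows "(\<integral>\<^sup>+t\<in>{0..}. U (nat \<lfloor>t\<rfloor>) \<partial>(lborel :: real measure)) = (\<Sum>j. U j)"
proof -
  have "U (nat \<lfloor>t\<rfloor>) * indicator {0..} t = (\<Sum>j. U j * indicator {real j..<real j + 1} t)" for t :: real
  proof (cases "0 \<le> t")
    case True
    have "(\<Sum>j. U j * indicator {real j..<real j + 1} t) =
        (\<Sum>j\<in>{nat \<lfloor>t\<rfloor>}. U j * indicator {real j..<real j + 1} t)"
    proof (rule suminf_finite)
      fix n assume "n \<notin> {nat \<lfloor>t\<rfloor>}"
      then have "t \<notin> {real n..<real n + 1}"
        by (auto dest!: floor_unique[of "int n" t, simplified])
      then show "U n * indicator {real n..<real n + 1} t = 0" by simp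
    qed simp
    moreover have "t \<in> {real (nat \<lfloor>t\<rfloor>)..<real (nat \<lfloor>t\<rfloor>) + 1}"
      using True by simp
    ultimately show ?thesis using True by simp
  next
    case False
    then have "indicator {real j..<real j + 1} t = (0::ennreal)" for j
      by (auto simp: indicator_def)
    with False show ?thesis by simp
  qed
  then have "(\<integral>\<^sup>+t\<in>{0..}. U (nat \<lfloor>t\<rfloor>) \<partial>(lborel :: real measure)) =
      (\<integral>\<^sup>+t. (\<Sum>j. U j * indicator {real j..<real j + 1} t) \<partial>lborel)"
    by simp
  also have "\<dots> = (\<Sum>j. \<integral>\<^sup>+t. U j * indicator {real j..<real j + 1} t \<partial>lborel)"
    by (rule nn_integral_suminf) simp
  also have "\<dots> = (\<Sum>j. U j)"
    by (simp add: nn_integral_cmult_indicator)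
  finally show ?thesis .
qed

text \<open>Round both functions down. The integer layer sums of the floors lie below the Choquet
  integrals, and restoring the lost fractions costs at most two extra levels, each of measure at
  most \<open>m (space F)\<close>.\<close>

lemma choquet_add_le_defect:
  assumes m: "fuzzy_measure F m" and sm: "submodular_on F m"
    and [measurable]: "f \<in> borel_measurable F" "g \<in> borel_measurable F"
    and f: "\<And>z. z \<in> space F \<Longrightarrow> 0 \<le> f z" and g: "\<And>z. z \<in> space F \<Longrightarrow> 0 \<le> g z"
  shows "choquet F m (\<lambda>z. f z + g z) \<le> choquet F m f + choquet F m g + ennreal (2 * m (space F))"
proof -
  define u where "u = (\<lambda>z. nat \<lfloor>f z\<rfloor>)"
  define v where "v = (\<lambda>z. nat \<lfloor>g z\<rfloor>)"
  have [measurable]: "u \<in> measurable F (count_space UNIV)" "v \<in> measurable F (count_space UNIV)"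
    unfolding u_def v_def by measurable
  have lower: "(\<Sum>j. ennreal (m {z \<in> space F. j < nat \<lfloor>h z\<rfloor>})) \<le> choquet F m h"
    if [measurable]: "h \<in> borel_measurable F" for h
    unfolding nn_integral_nat_floor[symmetric] choquet_def
  proof (intro nn_integral_mono)
    fix t :: real
    show "ennreal (m {z \<in> space F. nat \<lfloor>t\<rfloor> < nat \<lfloor>h z\<rfloor>}) * indicator {0..} t
        \<le> ennreal (m {z \<in> space F. t < h z}) * indicator {0..} t"
    proof (cases "0 \<le> t")
      case True
      have "t < h z" if "nat \<lfloor>t\<rfloor> < nat \<lfloor>h z\<rfloor>" for z
        using True that by linarith
      then have "{z \<in> space F. nat \<lfloor>t\<rfloor> < nat \<lfloor>h z\<rfloor>} \<subseteq> {z \<in> space F. t < h z}" by auto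
      with True show ?thesis by (auto intro!: ennreal_leI fuzzy_measureD(3)[OF m])
    qed simp
  qed
  \<comment> \<open>The \<open>2\<close> absorbs the two fractional parts:
    \<open>f + g < u + v + 2\<close> on the space.\<close>
  define W where "W = (\<lambda>j. ennreal (m {z \<in> space F. j < u z + v z + 2}))"
  have nonneg: "0 \<le> m {z \<in> space F. j < w z}"
    if [measurable]: "w \<in> measurable F (count_space UNIV)" for j and w :: "_ \<Rightarrow> nat"
  proof (rule fuzzy_measureD(2)[OF m])
    show "{z \<in> space F. j < w z} \<in> sets F" by measurable
  qed
  have tail: "(\<Sum>j. W (j + 2)) \<le> choquet F m f + choquet F m g"
  proof (rule suminf_le_const)
    fix J
    have "(\<Sum>j<J. W (j + 2)) = ennreal (\<Sum>j<J. m {z \<in> space F. j < u z + v z})"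
      by (simp add: W_def nonneg sum_ennreal)
    also have "\<dots> \<le> ennreal ((\<Sum>j<J. m {z \<in> space F. j < u z}) + (\<Sum>j<J. m {z \<in> space F. j < v z}))"
      by (intro ennreal_leI layer_sum_add_le[OF m sm]) measurable
    also have "\<dots> = (\<Sum>j<J. ennreal (m {z \<in> space F. j < u z})) + (\<Sum>j<J. ennreal (m {z \<in> space F. j < v z}))"
      by (simp add: nonneg sum_ennreal sum_nonneg)
    also have "\<dots> \<le> (\<Sum>j. ennreal (m {z \<in> space F. j < u z})) + (\<Sum>j. ennreal (m {z \<in> space F. j < v z}))"
      by (intro add_mono sum_le_suminf) auto
    also have "\<dots> \<le> choquet F m f + choquet F m g"
      unfolding u_def v_def by (intro add_mono lower) measurable
    finally show "(\<Sum>j<J. W (j + 2)) \<le> choquet F m f + choquet F m g" .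
  qed simp
  have "choquet F m (\<lambda>z. f z + g z) \<le> (\<Sum>j. W j)"
    unfolding nn_integral_nat_floor[symmetric] choquet_def
  proof (intro nn_integral_mono)
    fix t :: real
    show "ennreal (m {z \<in> space F. t < f z + g z}) * indicator {0..} t
        \<le> W (nat \<lfloor>t\<rfloor>) * indicator {0..} t"
    proof (cases "0 \<le> t")
      case True
      have "nat \<lfloor>t\<rfloor> < u z + v z + 2" if "t < f z + g z" "z \<in> space F" for z
        using True that(1) f[OF that(2)] g[OF that(2)] unfolding u_def v_def by linarith
      then have "{z \<in> space F. t < f z + g z} \<subseteq> {z \<in> space F. nat \<lfloor>t\<rfloor> < u z + v z + 2}" by auto
      with True show ?thesis
        by (auto simp: W_def intro!: ennreal_leI fuzzy_measureD(3)[OF m])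
    qed simp
  qed
  \<comment> \<open>Levels \<open>0\<close> and \<open>1\<close> of \<open>u + v + 2\<close> are the
    whole space and give the defect; the higher ones are the layers of \<open>u + v\<close>.\<close>
  also have "(\<Sum>j. W j) = (\<Sum>j. W (j + 2)) + (\<Sum>j<2. W j)"
    by (rule suminf_offset) simp
  also have "(\<Sum>j<2. W j) = ennreal (m (space F)) + ennreal (m (space F))"
    by (simp add: W_def numeral_2_eq_2 mult_2)
  also have "\<dots> = ennreal (2 * m (space F))"
    unfolding mult_2 by (rule ennreal_plus[symmetric]; rule fuzzy_measureD(2)[OF m]; simp)
  finally show ?thesis using add_right_mono[OF tail] by (rule order_trans)
qed

text \<open>The defect in the previous lemma is bounded independently of \<open>f\<close> and \<open>g\<close>, so it disappears
  after replacing them by \<open>n f\<close> and \<open>n g\<close>, dividing by \<open>n\<close> and letting \<open>n \<rightarrow> \<infinity>\<close>.\<close>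

lemma choquet_add_le:
  assumes m: "fuzzy_measure F m" and sm: "submodular_on F m"
    and [measurable]: "f \<in> borel_measurable F" "g \<in> borel_measurable F"
    and f: "\<And>z. z \<in> space F \<Longrightarrow> 0 \<le> f z" and g: "\<And>z. z \<in> space F \<Longrightarrow> 0 \<le> g z"
  shows "choquet F m (\<lambda>z. f z + g z) \<le> choquet F m f + choquet F m g"
proof (cases "choquet F m f + choquet F m g = \<infinity>")
  case True
  then show ?thesis by (simp only: infinity_ennreal_def top_greatest)
next
  case False
  define s where "s = enn2real (choquet F m f + choquet F m g)"
  have s: "choquet F m f + choquet F m g = ennreal s" "0 \<le> s"
    using False by (simp_all add: s_def less_top)
  define K where "K = 2 * m (space F)"
  have K: "0 \<le> K" using fuzzy_measureD(2)[OF m, of "space F"] by (simp add: K_def)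
  have bound: "ennreal (real n) * choquet F m (\<lambda>z. f z + g z) \<le> ennreal (real n * s + K)" for n :: nat
  proof -
    have "ennreal (real n) * choquet F m (\<lambda>z. f z + g z) = choquet F m (\<lambda>z. real n * f z + real n * g z)"
      by (subst choquet_mult[OF m, symmetric]) (simp_all add: algebra_simps)
    also have "\<dots> \<le> choquet F m (\<lambda>z. real n * f z) + choquet F m (\<lambda>z. real n * g z) + ennreal K"
      unfolding K_def using f g by (intro choquet_add_le_defect[OF m sm]) simp_all
    also have "\<dots> = ennreal (real n) * (choquet F m f + choquet F m g) + ennreal K"
      by (simp add: choquet_mult[OF m] distrib_left)
    also have "\<dots> = ennreal (real n * s + K)"
      using s K by (simp add: ennreal_mult)
    finally show ?thesis .
  qed
  define c where "c = enn2real (choquet F m (\<lambda>z. f z + g z))"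
  \<comment> \<open>The case \<open>n = 1\<close> of \<open>bound\<close> gives finiteness, which
    allows the passage to real numbers and the Archimedean argument.\<close>
  have "choquet F m (\<lambda>z. f z + g z) < \<infinity>"
    using le_less_trans[OF bound[of 1] ennreal_less_top] by simp
  then have c: "choquet F m (\<lambda>z. f z + g z) = ennreal c" "0 \<le> c"
    by (simp_all add: c_def)
  have "real n * (c - s) \<le> K" for n :: nat
  proof -
    have "ennreal (real n * c) \<le> ennreal (real n * s + K)"
      using bound[of n] c by (simp add: ennreal_mult)
    then have "real n * c \<le> real n * s + K"
      using s K by (subst (asm) ennreal_le_iff) simp_all
    then show ?thesis by (simp add: algebra_simps)
  qed
  then have "c \<le> s"
    by (meson diff_gt_0_iff_gt not_le reals_Archimedean3)
  then show ?thesis using c s by (simp add: ennreal_leI)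
qed

lemma choquet_sum_le:
  assumes m: "fuzzy_measure F m" and sm: "submodular_on F m" and "finite I"
    and "\<And>i. i \<in> I \<Longrightarrow> f i \<in> borel_measurable F"
    and "\<And>i z. i \<in> I \<Longrightarrow> z \<in> space F \<Longrightarrow> 0 \<le> f i z"
  shows "choquet F m (\<lambda>z. \<Sum>i\<in>I. f i z) \<le> (\<Sum>i\<in>I. choquet F m (f i))"
  using \<open>finite I\<close> assms(4,5)
proof (induction I rule: finite_induct)
  case empty
  then show ?case using choquet_zero[OF m] by simp
next
  case (insert i I)
  have "choquet F m (\<lambda>z. \<Sum>j\<in>insert i I. f j z) = choquet F m (\<lambda>z. f i z + (\<Sum>j\<in>I. f j z))"
    using insert.hyps by simp
  also have "\<dots> \<le> choquet F m (f i) + choquet F m (\<lambda>z. \<Sum>j\<in>I. f j z)"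
    using insert.prems by (intro choquet_add_le[OF m sm]) (auto intro!: sum_nonneg borel_measurable_sum)
  also have "\<dots> \<le> choquet F m (f i) + (\<Sum>j\<in>I. choquet F m (f j))"
    using insert by (intro add_left_mono) auto
  finally show ?case using insert.hyps by simp
qed

section \<open>Sections and strips of a decomposable measure\<close>

lemma section_at_measurable:
  assumes "H \<in> sets (agents M)"
  shows "section_at M H y \<in> sets M"
proof -
  have "section_at M H y = (\<lambda>x. (x, y)) -` H"
    using sets.sets_into_space[OF assms] by (auto simp: section_at_def space_pair_measure)
  then show ?thesis using sets_Pair2[OF assms] by simp
qed

text \<open>The indicator extends the weight by 0 from \<open>[0,1]\<close> to the whole line, where
  it can be integrated against \<open>lborel\<close>.\<close>

lemma decomposition_weight_measurable:
  assumes "decomposition M \<mu> m" and "H \<in> sets (agents M)"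
  shows "(\<lambda>y. indicator {0..1} y *\<^sub>R \<mu> y (section_at M H y)) \<in> borel_measurable borel"
proof -
  have "(\<lambda>y. \<mu> y (section_at M H y)) \<in> borel_measurable unit_borel"
    using assms by (auto simp: decomposition_def)
  then show ?thesis
    by (subst (asm) borel_measurable_restrict_space_iff) (simp_all add: mult.commute)
qed

text \<open>The integral in \<open>decomposition\<close> is a Bochner integral, which defaults to 0
  on non-integrable functions. Equiboundedness of the \<open>\<mu> y\<close> makes the weight
  integrable, so it agrees with the nonnegative integral.\<close>

lemma decomposition_nn_integral:
  assumes dec: "decomposition M \<mu> m" and H: "H \<in> sets (agents M)"
  shows "ennreal (m H) = (\<integral>\<^sup>+y\<in>{0..1}. ennreal (\<mu> y (section_at M H y)) \<partial>lborel)"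
proof -
  define w where "w = (\<lambda>y. indicator {0..1} y *\<^sub>R \<mu> y (section_at M H y))"
  have [measurable]: "w \<in> borel_measurable borel"
    unfolding w_def by (rule decomposition_weight_measurable[OF dec H])
  obtain K where K: "\<And>y A. y \<in> {0..1} \<Longrightarrow> A \<in> sets M \<Longrightarrow> \<mu> y A \<le> K"
    using dec unfolding decomposition_def by blast
  have nonneg: "0 \<le> \<mu> y (section_at M H y)" if "y \<in> {0..1}" for y
    using dec that section_at_measurable[OF H]
    by (intro fuzzy_measureD(2)[of M]) (auto simp: decomposition_def)
  have "integrable lborel w"
  proof (rule Bochner_Integration.integrable_bound)
    show "integrable lborel (\<lambda>y::real. indicator {0..1} y *\<^sub>R K)"
      by (rule integrable_real_indicator[THEN integrable_scaleR_left]) simp_all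
    show "AE y in lborel. norm (w y) \<le> norm (indicator {0..1} y *\<^sub>R K)"
    proof (rule AE_I2)
      fix y :: real
      show "norm (w y) \<le> norm (indicator {0..1} y *\<^sub>R K)"
      proof (cases "y \<in> {0..1}")
        case True
        with nonneg[OF True] K[OF True section_at_measurable[OF H, of y]] show ?thesis
          by (simp add: w_def)
      qed (simp add: w_def)
    qed
  qed simp
  then have "(\<integral>\<^sup>+y. ennreal (w y) \<partial>lborel) = ennreal (\<integral>y. w y \<partial>lborel)"
    using nonneg by (intro nn_integral_eq_integral) (auto simp: w_def indicator_def)
  also have "(\<integral>y. w y \<partial>lborel) = m H"
    using dec H by (simp add: decomposition_def set_lebesgue_integral_def w_def)
  moreover have "ennreal (w y) = ennreal (\<mu> y (section_at M H y)) * indicator {0..1} y" for y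
    by (simp add: w_def indicator_def)
  ultimately show ?thesis by simp
qed

lemma decomposition_strip:
  assumes dec: "decomposition M \<mu> m" and H: "H \<in> sets (agents M)" and Y: "Y \<in> sets borel"
  shows "{z \<in> H. snd z \<in> Y} \<in> sets (agents M)"
    and "ennreal (m {z \<in> H. snd z \<in> Y}) =
      (\<integral>\<^sup>+y\<in>{0..1}. ennreal (\<mu> y (section_at M H y)) * indicator Y y \<partial>lborel)"
proof -
  have "snd \<in> measurable (agents M) borel"
    by (rule measurable_compose[OF measurable_snd]) (simp add: measurable_restrict_space1)
  from measurable_sets[OF this Y] have "snd -` Y \<inter> space (agents M) \<in> sets (agents M)" .
  moreover have "{z \<in> H. snd z \<in> Y} = H \<inter> (snd -` Y \<inter> space (agents M))"
    using sets.sets_into_space[OF H] by auto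
  ultimately show *: "{z \<in> H. snd z \<in> Y} \<in> sets (agents M)" using H by auto
  \<comment> \<open>The cut only selects values of \<open>y\<close>, so each section is either kept
    whole or becomes empty.\<close>
  have "section_at M {z \<in> H. snd z \<in> Y} y = (if y \<in> Y then section_at M H y else {})" for y
    by (auto simp: section_at_def)
  moreover have "\<mu> y {} = 0" if "y \<in> {0..1}" for y
    using dec that by (auto simp: decomposition_def fuzzy_measure_def)
  ultimately show "ennreal (m {z \<in> H. snd z \<in> Y}) =
      (\<integral>\<^sup>+y\<in>{0..1}. ennreal (\<mu> y (section_at M H y)) * indicator Y y \<partial>lborel)"
    unfolding decomposition_nn_integral[OF dec *]
    by (intro nn_integral_cong) (auto simp: indicator_def)
qed

text \<open>Neither \<open>m\<close> nor \<open>\<mu> y\<close> need be additive, but no section is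
  ever divided here, so additivity is inherited from the Lebesgue integral in
  \<open>y\<close>.\<close>

lemma decomposition_split:
  assumes dec: "decomposition M \<mu> m" and fm: "fuzzy_measure (agents M) m"
    and H: "H \<in> sets (agents M)" and Y: "Y \<in> sets borel"
  shows "m H = m {z \<in> H. snd z \<in> Y} + m {z \<in> H. snd z \<notin> Y}"
proof -
  define w where "w = (\<lambda>y. indicator {0..1} y *\<^sub>R \<mu> y (section_at M H y))"
  have [measurable]: "w \<in> borel_measurable borel" "Y \<in> sets borel"
    unfolding w_def by (rule decomposition_weight_measurable[OF dec H], rule Y)
  have strip: "ennreal (m {z \<in> H. snd z \<in> Z}) = (\<integral>\<^sup>+y. ennreal (w y) * indicator Z y \<partial>lborel)"
    if "Z \<in> sets borel" for Z
    unfolding decomposition_strip(2)[OF dec H that]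
    by (intro nn_integral_cong) (auto simp: w_def indicator_def)
  have "ennreal (m {z \<in> H. snd z \<in> Y}) + ennreal (m {z \<in> H. snd z \<in> - Y}) =
      (\<integral>\<^sup>+y. ennreal (w y) * indicator Y y + ennreal (w y) * indicator (- Y) y \<partial>lborel)"
    using Y by (simp only: strip borel_comp) (subst nn_integral_add, simp_all)
  also have "\<dots> = (\<integral>\<^sup>+y. ennreal (w y) * indicator UNIV y \<partial>lborel)"
    by (intro nn_integral_cong) (auto simp: indicator_def)
  also have "\<dots> = ennreal (m H)"
    using strip[of UNIV] by simp
  finally have "ennreal (m {z \<in> H. snd z \<in> Y}) + ennreal (m {z \<in> H. snd z \<in> - Y}) = ennreal (m H)" .
  moreover have nonneg: "0 \<le> m {z \<in> H. snd z \<in> Z}" if "Z \<in> sets borel" for Z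
    by (rule fuzzy_measureD(2)[OF fm decomposition_strip(1)[OF dec H that]])
  ultimately have "ennreal (m {z \<in> H. snd z \<in> Y} + m {z \<in> H. snd z \<in> - Y}) = ennreal (m H)"
    using Y by (simp only: ennreal_plus borel_comp)
  then show ?thesis
    using nonneg[of Y] nonneg[of "- Y"] fuzzy_measureD(2)[OF fm H] Y
    by (subst (asm) ennreal_inj) auto
qed

section \<open>Integrals of sectional functions\<close>

text \<open>Setting \<open>f\<close> to 0 off \<open>A\<close> adds no point to the layers, since
  only levels \<open>t \<ge> 0\<close> are integrated.\<close>

lemma choquet_on_layer:
  assumes "A \<in> sets F"
  shows "choquet_on F m A f = (\<integral>\<^sup>+t\<in>{0..}. ennreal (m {z \<in> A. t < f z}) \<partial>lborel)"
proof -
  have "{z \<in> space F. t < f z * indicator A z} = {z \<in> A. t < f z}" if "0 \<le> t" for t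
    using that sets.sets_into_space[OF assms] by (auto simp: indicator_def split: if_splits)
  then show ?thesis
    unfolding choquet_on_def choquet_def
    by (intro nn_integral_cong) (auto simp: indicator_def)
qed

text \<open>Tonelli turns the Choquet integral of a sectional function into a Lebesgue integral; this is
  what makes the Choquet integral additive on sectional functions.\<close>

lemma choquet_on_sectional:
  assumes dec: "decomposition M \<mu> m" and S: "S \<in> sets (agents M)"
    and [measurable]: "\<phi> \<in> borel_measurable borel"
  shows "choquet_on (agents M) m S (\<lambda>z. \<phi> (snd z)) =
    (\<integral>\<^sup>+y\<in>{0..1}. ennreal (\<mu> y (section_at M S y)) * ennreal (\<phi> y) \<partial>lborel)"
proof -
  define w where "w = (\<lambda>y. indicator {0..1} y *\<^sub>R \<mu> y (section_at M S y))"
  have [measurable]: "w \<in> borel_measurable borel"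
    unfolding w_def by (rule decomposition_weight_measurable[OF dec S])
  have "ennreal (m {z \<in> S. t < \<phi> (snd z)}) = (\<integral>\<^sup>+y. ennreal (w y) * indicator {y. t < \<phi> y} y \<partial>lborel)" for t
  proof -
    have "{y. t < \<phi> y} \<in> sets borel" by measurable
    from decomposition_strip(2)[OF dec S this] show ?thesis
      by (auto simp: w_def indicator_def intro!: nn_integral_cong)
  qed
  then have "choquet_on (agents M) m S (\<lambda>z. \<phi> (snd z)) =
      (\<integral>\<^sup>+t. (\<integral>\<^sup>+y. ennreal (w y) * indicator {y. t < \<phi> y} y \<partial>lborel) * indicator {0..} t \<partial>lborel)"
    by (simp add: choquet_on_layer[OF S])
  \<comment> \<open>The layer condition becomes an indicator on the plane, so that the integrand is
    jointly measurable in \<open>t\<close> and \<open>y\<close>.\<close>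
  also have "\<dots> = (\<integral>\<^sup>+t. (\<integral>\<^sup>+y. ennreal (w y) * (indicator {0..} t * indicator {z. fst z < \<phi> (snd z)} (t, y)) \<partial>lborel) \<partial>lborel)"
    by (subst nn_integral_multc[symmetric]) (auto simp: indicator_def intro!: nn_integral_cong)
  also have "\<dots> = (\<integral>\<^sup>+y. (\<integral>\<^sup>+t. ennreal (w y) * (indicator {0..} t * indicator {z. fst z < \<phi> (snd z)} (t, y)) \<partial>lborel) \<partial>lborel)"
    by (rule lborel_pair.Fubini') measurable
  \<comment> \<open>For fixed \<open>y\<close> the admissible levels form an interval of length
    \<open>\<phi> y\<close>; for negative \<open>\<phi> y\<close> it is empty, in accordance with
    \<open>ennreal\<close> being 0 there.\<close>
  also have "\<dots> = (\<integral>\<^sup>+y. (\<integral>\<^sup>+t. ennreal (w y) * indicator {0..<\<phi> y} t \<partial>lborel) \<partial>lborel)"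
    by (intro nn_integral_cong) (auto simp: indicator_def)
  also have "\<dots> = (\<integral>\<^sup>+y. ennreal (w y) * ennreal (\<phi> y) \<partial>lborel)"
  proof (rule nn_integral_cong)
    fix y
    show "(\<integral>\<^sup>+t. ennreal (w y) * indicator {0..<\<phi> y} t \<partial>lborel) = ennreal (w y) * ennreal (\<phi> y)"
      by (cases "0 \<le> \<phi> y") (simp_all add: nn_integral_cmult_indicator ennreal_neg)
  qed
  also have "\<dots> = (\<integral>\<^sup>+y\<in>{0..1}. ennreal (\<mu> y (section_at M S y)) * ennreal (\<phi> y) \<partial>lborel)"
    by (intro nn_integral_cong) (auto simp: w_def indicator_def)
  finally show ?thesis .
qed

section \<open>From a comparison of integrals to a null coalition\<close>

text \<open>Otherwise the open interval would be a null set despite its positive length. This finds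
  good levels between any two rationals.\<close>

lemma ex_in_interval_if_AE:
  fixes q r :: real
  assumes "AE t in lborel. P t" and "q < r"
  shows "\<exists>t. q < t \<and> t < r \<and> P t"
proof (rule ccontr)
  assume "\<not> ?thesis"
  then have "AE t in lborel. t \<notin> {q<..<r}"
    using assms(1) by (auto elim!: AE_mp)
  then have "{q<..<r} \<in> null_sets lborel"
    by (subst (asm) AE_iff_null_sets[symmetric]) simp_all
  then show False using assms(2) by (auto simp: null_sets_def)
qed

text \<open>Equality of the two integrals forces the strip \<open>{\<phi> \<le> t < h}\<close> to be null for almost every
  \<open>t\<close>; countably many such \<open>t\<close> already exhaust \<open>{\<phi> < h}\<close>.\<close>

lemma null_if_choquet_on_le_sectional:
  assumes dec: "decomposition M \<mu> m" and fm: "fuzzy_measure (agents M) m"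
    and sm: "submodular_on (agents M) m" and ns: "null_sets_countably_stable (agents M) m"
    and S: "S \<in> sets (agents M)"
    and h: "h \<in> borel_measurable (agents M)" and \<phi> [measurable]: "\<phi> \<in> borel_measurable borel"
    and \<phi>_nonneg: "\<And>y. 0 \<le> \<phi> y"
    and less: "fuzzy_ae_in (agents M) m S (\<lambda>z. \<phi> (snd z) < h z)"
    and fin: "choquet_on (agents M) m S (\<lambda>z. \<phi> (snd z)) < \<infinity>"
    and le: "choquet_on (agents M) m S h \<le> choquet_on (agents M) m S (\<lambda>z. \<phi> (snd z))"
  shows "m S = 0"
proof -
  obtain N where N: "N \<in> sets (agents M)" "m N = 0" "\<And>z. z \<in> S \<Longrightarrow> z \<notin> N \<Longrightarrow> \<phi> (snd z) < h z"
    using less by (auto simp: fuzzy_ae_in_def)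
  have \<phi>_snd: "(\<lambda>z. \<phi> (snd z)) \<in> borel_measurable (agents M)"
    by (intro measurable_compose[OF measurable_snd] measurable_restrict_space1 \<phi>)
  define a where "a = (\<lambda>t. m {z \<in> S. t < h z})"
  define b where "b = (\<lambda>t. m {z \<in> S. t < \<phi> (snd z)})"
  define D where "D = (\<lambda>t. {z \<in> S. t < h z \<and> \<phi> (snd z) \<le> t})"
  have [measurable]: "a \<in> borel_measurable borel" "b \<in> borel_measurable borel"
    unfolding a_def b_def by (intro layer_measurable[OF fm S] h \<phi>_snd)+
  have b_nonneg: "0 \<le> b t" for t
    unfolding b_def by (rule fuzzy_measureD(2)[OF fm layer_sets[OF S \<phi>_snd]])
  \<comment> \<open>Split \<open>{t < h}\<close> by whether \<open>\<phi>\<close> exceeds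
    \<open>t\<close>. The part where it does contains, up to \<open>N\<close>, the whole layer of
    \<open>\<phi>\<close>; the other part is \<open>D t\<close>.\<close>
  have D: "D t \<in> sets (agents M)" and abD: "b t + m (D t) \<le> a t" for t
  proof -
    have Y: "{y. t < \<phi> y} \<in> sets borel" "{y. \<phi> y \<le> t} \<in> sets borel" by measurable
    note H = layer_sets[OF S h, of t]
    have D_eq: "D t = {z \<in> {z \<in> S. t < h z}. snd z \<in> {y. \<phi> y \<le> t}}"
      by (auto simp: D_def)
    show "D t \<in> sets (agents M)"
      unfolding D_eq by (rule decomposition_strip(1)[OF dec H Y(2)])
    let ?E = "{z \<in> {z \<in> S. t < h z}. snd z \<in> {y. t < \<phi> y}}"
    have E: "?E \<in> sets (agents M)"
      by (rule decomposition_strip(1)[OF dec H Y(1)])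
    have "a t = m ?E + m {z \<in> {z \<in> S. t < h z}. snd z \<notin> {y. t < \<phi> y}}"
      unfolding a_def by (rule decomposition_split[OF dec fm H Y(1)])
    also have "{z \<in> {z \<in> S. t < h z}. snd z \<notin> {y. t < \<phi> y}} = D t"
      by (auto simp: D_def)
    finally have "a t = m ?E + m (D t)" .
    moreover have "b t \<le> m (?E \<union> N)"
      unfolding b_def using N E
      by (intro fuzzy_measureD(3)[OF fm] layer_sets[OF S \<phi>_snd]) (auto dest: N(3))
    moreover have "m (?E \<union> N) \<le> m ?E"
      using submodular_imp_subadditive[OF fm sm E N(1)] N(2) by simp
    ultimately show "b t + m (D t) \<le> a t" by linarith
  qed
  have D_nonneg: "0 \<le> m (D t)" for t by (rule fuzzy_measureD(2)[OF fm D])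
  have ab: "b t \<le> a t" for t using abD[of t] D_nonneg[of t] by linarith
  let ?I = "\<lambda>f. \<integral>\<^sup>+t\<in>{0..}. ennreal (f t) \<partial>lborel"
  have "?I b + ?I (\<lambda>t. a t - b t) =
      (\<integral>\<^sup>+t. ennreal (b t) * indicator {0..} t + ennreal (a t - b t) * indicator {0..} t \<partial>lborel)"
    by (subst nn_integral_add) simp_all
  also have "\<dots> = ?I a"
  proof (rule nn_integral_cong)
    fix t
    have "ennreal (b t) + ennreal (a t - b t) = ennreal (a t)"
      using b_nonneg[of t] ab[of t] by (simp flip: ennreal_plus)
    then show "ennreal (b t) * indicator {0..} t + ennreal (a t - b t) * indicator {0..} t =
        ennreal (a t) * indicator {0..} t"
      by (simp flip: distrib_right)
  qed
  also have "\<dots> \<le> ?I b"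
    using le by (simp add: choquet_on_layer[OF S] a_def b_def)
  finally have "?I b + ?I (\<lambda>t. a t - b t) \<le> ?I b + 0" by simp
  \<comment> \<open>Finiteness permits cancelling the integral of \<open>b\<close>, which leaves a
    nonnegative integrand with integral 0.\<close>
  moreover have "?I b < top"
    using fin by (simp add: choquet_on_layer[OF S] b_def)
  ultimately have "?I (\<lambda>t. a t - b t) = 0"
    by (simp only: ennreal_add_left_cancel_le) auto
  then have "AE t in lborel. ennreal (a t - b t) * indicator {0..} t = 0"
    by (subst (asm) nn_integral_0_iff_AE) simp_all
  then have "AE t in lborel. 0 \<le> t \<longrightarrow> m (D t) = 0"
  proof (rule AE_mp, intro AE_I2 impI)
    fix t :: real
    assume "ennreal (a t - b t) * indicator {0..} t = 0" and "0 \<le> t"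
    then have "a t - b t \<le> 0" by (simp add: ennreal_eq_0_iff)
    with abD[of t] D_nonneg[of t] show "m (D t) = 0" by linarith
  qed
  \<comment> \<open>Rational levels themselves may be exceptional, so a good level is chosen inside
    each rational interval.\<close>
  then have "\<exists>t. q < t \<and> t < r \<and> (0 \<le> t \<longrightarrow> m (D t) = 0)" if "q < r" for q r
    using that by (rule ex_in_interval_if_AE)
  then obtain \<tau> where \<tau>: "\<And>q r. q < r \<Longrightarrow> q < \<tau> q r \<and> \<tau> q r < r \<and> (0 \<le> \<tau> q r \<longrightarrow> m (D (\<tau> q r)) = 0)"
    by metis
  define T :: "rat \<times> rat \<Rightarrow> real" where "T = (\<lambda>(q, r). \<tau> (of_rat q) (of_rat r))"
  \<comment> \<open>Enumerates the rational pairs; those that do not bound an interval of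
    nonnegative levels get the empty set, which is null.\<close>
  define Z where "Z = (\<lambda>k::nat. let p = from_nat k in if 0 \<le> fst p \<and> fst p < snd p then D (T p) else {})"
  have "Z k \<in> sets (agents M) \<and> m (Z k) = 0" for k
  proof -
    obtain q r :: rat where qr: "from_nat k = (q, r)" by force
    have "m (D (T (q, r))) = 0" if "0 \<le> q" "q < r"
    proof -
      have "(of_rat q :: real) < of_rat r" and "(0::real) \<le> of_rat q"
        using that by (simp_all add: of_rat_less)
      with \<tau>[OF this(1)] have "0 \<le> \<tau> (of_rat q) (of_rat r)" by linarith
      with \<tau>[OF \<open>(of_rat q :: real) < of_rat r\<close>] show ?thesis by (simp add: T_def)
    qed
    then show ?thesis using D fuzzy_measureD(1)[OF fm] by (simp add: Z_def qr)
  qed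
  then have Z: "(\<Union>k. Z k) \<in> sets (agents M)" "m (\<Union>k. Z k) = 0"
    using ns by (auto simp: null_sets_countably_stable_def)
  have "S \<subseteq> N \<union> (\<Union>k. Z k)"
  proof
    fix z assume "z \<in> S"
    show "z \<in> N \<union> (\<Union>k. Z k)"
    proof (cases "z \<in> N")
      case False
      \<comment> \<open>Two rationals fit between \<open>\<phi>\<close> and \<open>h\<close> at
        \<open>z\<close>. The level chosen between them also separates \<open>\<phi>\<close> from
        \<open>h\<close>, so \<open>z\<close> lies in its strip.\<close>
      from N(3)[OF \<open>z \<in> S\<close> False] obtain q where q: "\<phi> (snd z) < of_rat q" "of_rat q < h z"
        using of_rat_dense by blast
      from q(2) obtain r where r: "of_rat q < (of_rat r :: real)" "of_rat r < h z"
        using of_rat_dense by blast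
      have "0 \<le> (of_rat q :: real)" using \<phi>_nonneg[of "snd z"] q(1) by linarith
      then have "0 \<le> q" by simp
      moreover have "q < r" using r(1) by (simp add: of_rat_less)
      moreover have "z \<in> D (T (q, r))"
        using \<tau>[OF r(1)] q r \<open>z \<in> S\<close> by (auto simp: D_def T_def)
      ultimately have "z \<in> Z (to_nat (q, r))" by (simp add: Z_def)
      then show ?thesis by blast
    qed simp
  qed
  then have "m S \<le> m (N \<union> (\<Union>k. Z k))"
    using N Z by (intro fuzzy_measureD(3)[OF fm S]) auto
  also have "\<dots> \<le> m N + m (\<Union>k. Z k)"
    using N Z by (intro submodular_imp_subadditive[OF fm sm])
  finally show ?thesis using N Z fuzzy_measureD(2)[OF fm S] by simp
qed

section \<open>Values at prices and the economy\<close>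

text \<open>Homogeneity and subadditivity, applied to the coordinates of \<open>g\<close> weighted
  by \<open>p\<close>. As \<open>g\<close> need not be sectional, only an inequality is
  claimed.\<close>

lemma choquet_on_inner_le:
  assumes fm: "fuzzy_measure F m" and sm: "submodular_on F m" and S: "S \<in> sets F"
    and g: "allocation F g" and p: "p \<in> orthant"
  shows "choquet_on F m S (\<lambda>z. p \<bullet> g z) \<le> (\<Sum>i\<in>UNIV. ennreal (p $ i) * choquet_on F m S (\<lambda>z. g z $ i))"
proof -
  have [measurable]: "(\<lambda>z. g z $ i) \<in> borel_measurable F" "S \<in> sets F" for i
    using g S by (auto simp: allocation_def measurable_vec_def)
  have nonneg: "0 \<le> p $ i" "z \<in> space F \<Longrightarrow> 0 \<le> g z $ i" for i z
    using g p by (auto simp: allocation_def orthant_def)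
  have "choquet_on F m S (\<lambda>z. p \<bullet> g z) =
      choquet F m (\<lambda>z. \<Sum>i\<in>UNIV. p $ i * (g z $ i * indicator S z))"
    by (simp add: choquet_on_def inner_vec_def sum_distrib_right mult.assoc)
  also have "\<dots> \<le> (\<Sum>i\<in>UNIV. choquet F m (\<lambda>z. p $ i * (g z $ i * indicator S z)))"
    using nonneg by (intro choquet_sum_le[OF fm sm]) auto
  also have "\<dots> = (\<Sum>i\<in>UNIV. ennreal (p $ i) * choquet_on F m S (\<lambda>z. g z $ i))"
    using nonneg by (simp add: choquet_on_def choquet_mult[OF fm])
  finally show ?thesis .
qed

text \<open>Equality holds because the Choquet integral over \<open>S\<close> of a nonnegative
  sectional function is a Lebesgue integral with a weight independent of the function.\<close>

lemma choquet_on_inner_sectional: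
  fixes \<phi> :: "real \<Rightarrow> real ^ 'n"
  assumes dec: "decomposition M \<mu> m" and S: "S \<in> sets (agents M)"
    and \<phi> [measurable]: "\<And>i. (\<lambda>y. \<phi> y $ i) \<in> borel_measurable borel"
    and nonneg: "\<And>y. \<phi> y \<in> orthant" and p: "p \<in> orthant"
  shows "choquet_on (agents M) m S (\<lambda>z. p \<bullet> \<phi> (snd z)) =
    (\<Sum>i\<in>UNIV. ennreal (p $ i) * choquet_on (agents M) m S (\<lambda>z. \<phi> (snd z) $ i))"
proof -
  have nonneg: "0 \<le> p $ i" "0 \<le> \<phi> y $ i" for i y
    using nonneg p by (auto simp: orthant_def)
  define w where "w = (\<lambda>y. indicator {0..1} y *\<^sub>R \<mu> y (section_at M S y))"
  have [measurable]: "w \<in> borel_measurable borel"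
    unfolding w_def by (rule decomposition_weight_measurable[OF dec S])
  have sect: "choquet_on (agents M) m S (\<lambda>z. \<psi> (snd z)) = (\<integral>\<^sup>+y. ennreal (w y) * ennreal (\<psi> y) \<partial>lborel)"
    if "\<psi> \<in> borel_measurable borel" for \<psi>
    unfolding choquet_on_sectional[OF dec S that]
    by (intro nn_integral_cong) (auto simp: w_def indicator_def)
  have "choquet_on (agents M) m S (\<lambda>z. p \<bullet> \<phi> (snd z)) = (\<integral>\<^sup>+y. ennreal (w y) * ennreal (p \<bullet> \<phi> y) \<partial>lborel)"
    unfolding inner_vec_def by (rule sect) simp
  also have "\<dots> = (\<integral>\<^sup>+y. (\<Sum>i\<in>UNIV. ennreal (p $ i) * (ennreal (w y) * ennreal (\<phi> y $ i))) \<partial>lborel)"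
  proof (rule nn_integral_cong)
    fix y
    have "ennreal (p \<bullet> \<phi> y) = (\<Sum>i\<in>UNIV. ennreal (p $ i) * ennreal (\<phi> y $ i))"
      using nonneg by (simp add: inner_vec_def ennreal_mult flip: sum_ennreal)
    then show "ennreal (w y) * ennreal (p \<bullet> \<phi> y) =
        (\<Sum>i\<in>UNIV. ennreal (p $ i) * (ennreal (w y) * ennreal (\<phi> y $ i)))"
      by (simp add: sum_distrib_left mult.left_commute)
  qed
  also have "\<dots> = (\<Sum>i\<in>UNIV. \<integral>\<^sup>+y. ennreal (p $ i) * (ennreal (w y) * ennreal (\<phi> y $ i)) \<partial>lborel)"
    by (rule nn_integral_sum) simp
  also have "\<dots> = (\<Sum>i\<in>UNIV. ennreal (p $ i) * choquet_on (agents M) m S (\<lambda>z. \<phi> (snd z) $ i))"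
    by (simp add: nn_integral_cmult sect[OF \<phi>])
  finally show ?thesis .
qed

theorem theorem4p2:
  fixes M :: "'x measure"
    and \<mu> :: "real \<Rightarrow> 'x set \<Rightarrow> real"
    and m :: "('x \<times> real) set \<Rightarrow> real"
    and e :: "'x \<times> real \<Rightarrow> real ^ 'n"
    and pref :: "'x \<times> real \<Rightarrow> (real ^ 'n) rel"
  assumes "exchange_economy M \<mu> m e pref"
  shows "walras_allocations (agents M) m e pref \<subseteq> core (agents M) m e pref"
proof
  interpret exchange_economy M \<mu> m e pref by fact
  have fm: "fuzzy_measure (agents M) m" and dec: "decomposition M \<mu> m"
    using convex_type by (auto simp: convex_type_def)
  fix f assume "f \<in> walras_allocations (agents M) m e pref"
  then obtain p N where f: "feasible_allocation (agents M) m e f" and p: "p \<in> orthant"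
    and N: "N \<in> sets (agents M)" "m N = 0"
    and walras: "\<And>a u. a \<in> space (agents M) - N \<Longrightarrow> u \<in> orthant \<Longrightarrow>
        strictly_prefers pref a u (f a) \<Longrightarrow> p \<bullet> e a < p \<bullet> u"
    unfolding walras_allocations_def walras_equilibrium_def price_def fuzzy_ae_in_def by blast
  have "\<not> can_improve (agents M) m e pref S f" if coal: "coalition (agents M) m S" for S
  proof
    assume "can_improve (agents M) m e pref S f"
    then obtain g N' where g: "allocation (agents M) g"
      and N': "N' \<in> sets (agents M)" "m N' = 0"
      and better: "\<And>a. a \<in> S - N' \<Longrightarrow> strictly_prefers pref a (g a) (f a)"
      and vec_eq: "choquet_vec (agents M) m S g = choquet_vec (agents M) m S e"
      unfolding can_improve_def fuzzy_ae_in_def by blast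
    have S: "S \<in> sets (agents M)" "0 < m S" using coal by (auto simp: coalition_def)
    note S_space = sets.sets_into_space[OF S(1)]
    obtain \<psi> where \<psi>: "measurable_vec unit_borel \<psi>"
      and e_\<psi>: "\<And>x y. x \<in> space M \<Longrightarrow> y \<in> {0..1} \<Longrightarrow> e (x, y) = \<psi> y"
      using endowment_sectional unfolding sectional_def by blast
    \<comment> \<open>\<open>\<psi>\<close> is controlled on \<open>[0,1]\<close> only. The value 0
      elsewhere, and wherever \<open>\<psi>\<close> leaves the orthant, makes \<open>\<phi>\<close>
      Borel on the line and nonnegative everywhere without changing \<open>e\<close>.\<close>
    define \<phi> where "\<phi> = (\<lambda>y. if y \<in> {0..1} \<and> \<psi> y \<in> orthant then \<psi> y else 0)"
    have e_orthant: "e a \<in> orthant" if "a \<in> space (agents M)" for a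
      using endowment_interior[OF that] interior_subset by blast
    have e_\<phi>: "e a = \<phi> (snd a)" if "a \<in> space (agents M)" for a
      using that e_orthant[OF that] e_\<psi>[of "fst a" "snd a"]
      by (auto simp: \<phi>_def space_pair_measure)
    have \<phi>_orthant: "\<phi> y \<in> orthant" for y by (simp add: \<phi>_def orthant_def)
    have \<phi>_meas: "(\<lambda>y. \<phi> y $ i) \<in> borel_measurable borel" for i
    proof -
      have [measurable]: "(\<lambda>y. indicator {0..1} y *\<^sub>R \<psi> y $ j) \<in> borel_measurable borel" for j
        using \<psi> unfolding measurable_vec_def
        by (subst (asm) borel_measurable_restrict_space_iff) (simp_all add: mult.commute)
      \<comment> \<open>Outside \<open>[0,1]\<close> either branch is 0, so the condition may be
        tested on the cut-off coordinates, which are Borel on the line.\<close>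
      have eq: "\<phi> y $ i = (if \<forall>j. 0 \<le> indicator {0..1} y *\<^sub>R \<psi> y $ j then indicator {0..1} y *\<^sub>R \<psi> y $ i else 0)" for y
        by (auto simp: \<phi>_def orthant_def indicator_def)
      show ?thesis unfolding eq by measurable
    qed
    have e_int: "choquet_on (agents M) m S (\<lambda>z. \<phi> (snd z) $ i) = choquet_on (agents M) m S (\<lambda>z. e z $ i)" for i
      unfolding choquet_on_def by (rule choquet_cong) (simp add: e_\<phi>)
    have fin: "choquet_on (agents M) m S (\<lambda>z. e z $ i) < \<infinity>" for i
    proof -
      have [measurable]: "(\<lambda>z. e z $ i) \<in> borel_measurable (agents M)" "S \<in> sets (agents M)"
        using endowment_integrable S by (auto simp: L1_choquet_def measurable_vec_def)
      have "choquet_on (agents M) m S (\<lambda>z. e z $ i) \<le> choquet (agents M) m (\<lambda>z. e z $ i)"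
        unfolding choquet_on_def using e_orthant
        by (intro choquet_mono[OF fm]) (auto simp: indicator_def orthant_def)
      also have "\<dots> < \<infinity>" using endowment_integrable by (simp add: L1_choquet_def)
      finally show ?thesis .
    qed
    have g_int: "choquet_on (agents M) m S (\<lambda>z. g z $ i) = choquet_on (agents M) m S (\<lambda>z. \<phi> (snd z) $ i)" for i
      using vec_eq by (simp add: choquet_vec_def vec_eq_iff e_int)
    have "m S = 0"
    proof (rule null_if_choquet_on_le_sectional[OF dec fm submodular null_stable S(1)])
      show "(\<lambda>z. p \<bullet> g z) \<in> borel_measurable (agents M)"
        using g unfolding inner_vec_def allocation_def measurable_vec_def inner_real_def
        by (intro borel_measurable_sum borel_measurable_times borel_measurable_const) blast
      show "(\<lambda>y. p \<bullet> \<phi> y) \<in> borel_measurable borel"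
        using \<phi>_meas by (simp add: inner_vec_def)
      show "0 \<le> p \<bullet> \<phi> y" for y
        using p \<phi>_orthant[of y] by (auto simp: inner_vec_def orthant_def intro!: sum_nonneg)
      \<comment> \<open>Off \<open>N\<close> the equilibrium condition makes every preferred bundle
        unaffordable; on \<open>S\<close> off \<open>N'\<close> the bundle \<open>g z\<close> is
        preferred.\<close>
      show "fuzzy_ae_in (agents M) m S (\<lambda>z. p \<bullet> \<phi> (snd z) < p \<bullet> g z)"
        unfolding fuzzy_ae_in_def
      proof (intro bexI conjI ballI)
        show "N \<union> N' \<in> sets (agents M)" using N N' by auto
        show "m (N \<union> N') = 0"
          using submodular_imp_subadditive[OF fm submodular N(1) N'(1)] N N'
            fuzzy_measureD(2)[OF fm, of "N \<union> N'"] by auto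
        fix z assume "z \<in> S - (N \<union> N')"
        with S_space have "z \<in> space (agents M) - N" "z \<in> S - N'" "z \<in> space (agents M)" by auto
        moreover from this g have "g z \<in> orthant" by (auto simp: allocation_def)
        ultimately show "p \<bullet> \<phi> (snd z) < p \<bullet> g z"
          using walras better by (simp flip: e_\<phi>)
      qed
      show "choquet_on (agents M) m S (\<lambda>z. p \<bullet> \<phi> (snd z)) < \<infinity>"
        using fin unfolding choquet_on_inner_sectional[OF dec S(1) \<phi>_meas \<phi>_orthant p]
        by (auto simp: e_int ennreal_mult_less_top)
      \<comment> \<open>Subadditivity for \<open>g\<close>, then coordinatewise equality of the
        integrals over \<open>S\<close>, then additivity for the sectional endowment.\<close>
      show "choquet_on (agents M) m S (\<lambda>z. p \<bullet> g z) \<le> choquet_on (agents M) m S (\<lambda>z. p \<bullet> \<phi> (snd z))"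
        unfolding choquet_on_inner_sectional[OF dec S(1) \<phi>_meas \<phi>_orthant p]
        using choquet_on_inner_le[OF fm submodular S(1) g p] by (simp add: g_int)
    qed
    with S(2) show False by simp
  qed
  with f show "f \<in> core (agents M) m e pref" by (auto simp: core_def)
qed

end
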